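(* Let $K$ be a Hilbert space with $d=\dim K\in\{2,3,4,\dots\}$, let $\xi\in K$ be a unit vector, and let $a\in B(K)$ be self-adjoint. For $N\in\mathbb N$ let $b_N=a^{(1)}+\cdots+a^{(N)}$ acting on $K^{\otimes N}$, where $$a^{(i)}=I_K^{\otimes(i-1)}\otimes a\otimes P^{\otimes(N-i)},$$ with $P$ the orthogonal projection of $K$ onto $\mathbb C\xi$, and let $\omega$ be the trace on $B(K^{\otimes N})$. Then for every $k\in\mathbb N$, $$\lim_{N\to\infty}d^{-N}\omega(b_N^k)=\sum_{\pi\in\mathcal{OP}(k)}\frac{\omega(\pi)}{(d-1)^{|\pi|}}.$$
   Context: $\mathbb N=\{1,2,3,\dots\}$ and $[k]=\{1,\dots,k\}$. An ordered set partition of $[k]$ is a tuple $\pi=(B_1,\dots,B_p)$ of non-empty, mutually disjoint subsets of $[k]$ whose union is $[k]$; $|\pi|=p$ is its length, and $\mathcal{OP}(k)$ is the set of all ordered set partitions of $[k]$. For $\pi=(B_1,\dots,B_p)\in\mathcal{OP}(k)$ let $\mathbf i(\pi)=(i_1(\pi),\dots,i_k(\pi))\in[p]^k$ be the tuple with $i_j(\pi)=q$ iff $j\in B_q$. Define $\omega(\pi)=\omega\bigl(a^{(i_1(\pi))}a^{(i_2(\pi))}\cdots a^{(i_k(\pi))}\bigr)$, the trace being taken on $K^{\otimes N}$ for any $N\ge|\pi|$ (the value does not depend on such $N$). *)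

theory Defs
  imports Complex_Main "HOL-Library.Function_Algebras"
begin

class complex_vector = ab_group_add +
  fixes scaleC :: "complex \<Rightarrow> 'a \<Rightarrow> 'a"  (infixr "*\<^sub>C" 75)
  assumes scaleC_add_right: "c *\<^sub>C (x + y) = c *\<^sub>C x + c *\<^sub>C y"
    and scaleC_add_left: "(b + c) *\<^sub>C x = b *\<^sub>C x + c *\<^sub>C x"
    and scaleC_scaleC: "b *\<^sub>C (c *\<^sub>C x) = (b * c) *\<^sub>C x"
    and scaleC_one: "1 *\<^sub>C x = x"

global_interpretation complex_vector:
  vector_space "scaleC :: complex \<Rightarrow> 'a \<Rightarrow> 'a::complex_vector"
  by unfold_locales (rule scaleC_add_right scaleC_add_left scaleC_scaleC scaleC_one)+

instantiation complex :: complex_vector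
begin

definition scaleC_complex :: "complex \<Rightarrow> complex \<Rightarrow> complex"
  where "scaleC_complex c x = c * x"

instance
  by standard (simp_all add: scaleC_complex_def algebra_simps)

end

instantiation "fun" :: (type, complex_vector) complex_vector
begin

definition scaleC_fun :: "complex \<Rightarrow> ('a \<Rightarrow> 'b) \<Rightarrow> 'a \<Rightarrow> 'b"
  where "scaleC_fun c f = (\<lambda>x. c *\<^sub>C f x)"

instance
  by standard
    (simp_all add: scaleC_fun_def fun_eq_iff scaleC_add_right scaleC_add_left
      scaleC_scaleC scaleC_one)

end

abbreviation clinear :: "('a::complex_vector \<Rightarrow> 'b::complex_vector) \<Rightarrow> bool"
  where "clinear \<equiv> Vector_Spaces.linear scaleC scaleC"

text \<open>Complex inner product spaces, with the inner product linear in the second argument.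
  In finite dimension, which is the only case used below, these are exactly the Hilbert spaces,
  since completeness is automatic, and every linear operator is bounded.\<close>

class complex_inner = complex_vector +
  fixes cinner :: "'a \<Rightarrow> 'a \<Rightarrow> complex"
  assumes cinner_commute: "cinner x y = cnj (cinner y x)"
    and cinner_add_right: "cinner x (y + z) = cinner x y + cinner x z"
    and cinner_scaleC_right: "cinner x (c *\<^sub>C y) = c * cinner x y"
    and cinner_pos: "x \<noteq> 0 \<Longrightarrow> 0 < Re (cinner x x)"

definition selfadjoint :: "('a::complex_inner \<Rightarrow> 'a) \<Rightarrow> bool"
  where "selfadjoint T \<longleftrightarrow> clinear T \<and> (\<forall>x y. cinner (T x) y = cinner x (T y))"

definition orth_proj :: "'a::complex_inner set \<Rightarrow> 'a \<Rightarrow> 'a"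
  where "orth_proj V x = (THE y. y \<in> V \<and> (\<forall>v\<in>V. cinner v (x - y) = 0))"

text \<open>The tensor power of order \<open>N\<close> is realised in the usual way as a space of
  conjugate-multilinear forms: \<open>x1 \<otimes> ... \<otimes> xN\<close> is the form
  \<open>(y1, ..., yN) \<mapsto> \<langle>y1, x1\<rangle> ... \<langle>yN, xN\<rangle>\<close>, and the tensor power is the span of these forms.
  Tuples are lists, and forms are extended by \<open>0\<close> to lists of the wrong length.\<close>

definition elem_tensor :: "'a::complex_inner list \<Rightarrow> 'a list \<Rightarrow> complex"
  where "elem_tensor xs =
    (\<lambda>ys. if length ys = length xs then \<Prod>i<length xs. cinner (ys ! i) (xs ! i) else 0)"

definition tensor_power :: "nat \<Rightarrow> ('a::complex_inner list \<Rightarrow> complex) set"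
  where "tensor_power N = complex_vector.span (elem_tensor ` {xs. length xs = N})"

text \<open>The operator \<open>T1 \<otimes> ... \<otimes> TN\<close>. Its defining property determines it on the tensor power of
  order \<open>N\<close>; its values elsewhere are arbitrary and play no role.\<close>

definition tensor_op ::
    "('a::complex_inner \<Rightarrow> 'a) list \<Rightarrow> ('a list \<Rightarrow> complex) \<Rightarrow> ('a list \<Rightarrow> complex)"
  where "tensor_op Ts = (SOME T. clinear T \<and>
    (\<forall>xs. length xs = length Ts \<longrightarrow>
      T (elem_tensor xs) = elem_tensor (map2 (\<lambda>A x. A x) Ts xs)))"

text \<open>The (unnormalised) trace of an operator mapping the finite-dimensional subspace \<open>V\<close> to itself:
  the sum of the diagonal coefficients with respect to a basis of \<open>V\<close>.\<close>

definition trace_on :: "'v::complex_vector set \<Rightarrow> ('v \<Rightarrow> 'v) \<Rightarrow> complex"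
  where "trace_on V T =
    (let B = (SOME B. complex_vector.independent B \<and> complex_vector.span B = V)
     in \<Sum>b\<in>B. complex_vector.representation B (T b) b)"

definition tensor_trace ::
    "nat \<Rightarrow> (('a::complex_inner list \<Rightarrow> complex) \<Rightarrow> ('a list \<Rightarrow> complex)) \<Rightarrow> complex"
  where "tensor_trace N T = trace_on (tensor_power N) T"

definition leg_op :: "'a::complex_inner \<Rightarrow> ('a \<Rightarrow> 'a) \<Rightarrow> nat \<Rightarrow> nat \<Rightarrow>
    ('a list \<Rightarrow> complex) \<Rightarrow> ('a list \<Rightarrow> complex)"
  where "leg_op \<xi> a N i = tensor_op
    (replicate (i - 1) id @ [a] @ replicate (N - i) (orth_proj (complex_vector.span {\<xi>})))"

definition leg_sum :: "'a::complex_inner \<Rightarrow> ('a \<Rightarrow> 'a) \<Rightarrow> nat \<Rightarrow>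
    ('a list \<Rightarrow> complex) \<Rightarrow> ('a list \<Rightarrow> complex)"
  where "leg_sum \<xi> a N = (\<lambda>u. \<Sum>i = 1..N. leg_op \<xi> a N i u)"

text \<open>An ordered set partition is the list of its blocks; blocks are numbered from \<open>1\<close>, while
  list positions start at \<open>0\<close>.\<close>

definition ordered_set_partitions :: "nat \<Rightarrow> nat set list set"
  where "ordered_set_partitions k = {\<pi>.
    (\<forall>B\<in>set \<pi>. B \<noteq> {}) \<and>
    (\<forall>p<length \<pi>. \<forall>q<length \<pi>. p \<noteq> q \<longrightarrow> \<pi> ! p \<inter> \<pi> ! q = {}) \<and>
    \<Union> (set \<pi>) = {1..k}}"

lemma finite_ordered_set_partitions: "finite (ordered_set_partitions k)"
proof (rule finite_subset)
  show "ordered_set_partitions k \<subseteq> {\<pi>. set \<pi> \<subseteq> Pow {1..k} \<and> distinct \<pi>}"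
  proof
    fix \<pi> assume \<pi>: "\<pi> \<in> ordered_set_partitions k"
    have "distinct \<pi>"
      unfolding distinct_conv_nth
    proof (intro allI impI)
      fix p q assume pq: "p < length \<pi>" "q < length \<pi>" "p \<noteq> q"
      then have "\<pi> ! p \<inter> \<pi> ! q = {}" "\<pi> ! p \<noteq> {}"
        using \<pi> by (simp_all add: ordered_set_partitions_def)
      then show "\<pi> ! p \<noteq> \<pi> ! q" by blast
    qed
    moreover have "set \<pi> \<subseteq> Pow {1..k}"
      using \<pi> unfolding ordered_set_partitions_def by blast
    ultimately show "\<pi> \<in> {\<pi>. set \<pi> \<subseteq> Pow {1..k} \<and> distinct \<pi>}" by simp
  qed
  show "finite {\<pi>. set \<pi> \<subseteq> Pow {1..k} \<and> distinct \<pi>}"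
    by (rule finite_subset_distinct) simp
qed

definition block_index :: "nat set list \<Rightarrow> nat \<Rightarrow> nat"
  where "block_index \<pi> j = (THE q. 1 \<le> q \<and> q \<le> length \<pi> \<and> j \<in> \<pi> ! (q - 1))"

text \<open>The moment of the word indexed by \<open>\<pi>\<close>. The trace is taken on the tensor power of order
  \<open>length \<pi>\<close>; for \<open>k \<ge> 1\<close> any larger order gives the same value, each additional leg
  contributing the factor \<open>1\<close>, the trace of a power of a rank-one projection.\<close>

definition partition_moment ::
    "'a::complex_inner \<Rightarrow> ('a \<Rightarrow> 'a) \<Rightarrow> nat \<Rightarrow> nat set list \<Rightarrow> complex"
  where "partition_moment \<xi> a k \<pi> = tensor_trace (length \<pi>)
    (foldr (\<circ>) (map (\<lambda>j. leg_op \<xi> a (length \<pi>) (block_index \<pi> j)) [1..<k + 1]) id)"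

end

theory Submission
  imports Defs "HOL-Library.Infinite_Set"
begin

text \<open>
  Expanding \<open>b_N ^ k\<close> gives one word of leg operators for every index list \<open>is\<close> of length \<open>k\<close>
  over \<open>{1..N}\<close>. Each word is a tensor product of operators on the single legs, so its trace is a
  product over the legs (\<open>tensor_trace_product\<close>). On a leg \<open>j\<close> that does not occur in \<open>is\<close>, an
  index \<open>i\<close> contributes the identity if \<open>j < i\<close> and the projection \<open>P\<close> if \<open>i < j\<close>. Such a leg
  therefore carries the identity, with trace \<open>d\<close>, if it precedes every index of the word, and
  otherwise \<open>P\<close>, with trace \<open>1\<close>. On a leg that does occur, the operator depends only on how the
  entries of \<open>is\<close> compare with \<open>j\<close>. Hence the trace of the word is
  \<open>d ^ free_legs N (set is)\<close> times a weight that depends only on the relative order of the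
  indices (\<open>tensor_trace_word\<close>, \<open>pattern_weight_map\<close>).

  Grouping the words by their set \<open>R\<close> of indices and relabelling \<open>R\<close> increasingly by
  \<open>{1..p}\<close>, where \<open>p = card R\<close>, separates the two factors (\<open>sum_lists_by_pattern\<close>). The total
  weight of the lists with range \<open>{1..p}\<close> does not involve \<open>N\<close>, and these lists are the ordered
  set partitions of \<open>{1..k}\<close> with \<open>p\<close> blocks (\<open>sum_ordered_set_partitions\<close>). All dependence on
  \<open>N\<close> sits in \<open>\<Sum>R. d ^ free_legs N R\<close>, the sum over the subsets of \<open>{1..N}\<close> with \<open>p\<close>
  elements. This sum obeys Pascal's recursion, of which \<open>d ^ N / (d - 1) ^ p\<close> is an exact solution;
  the two solutions differ by \<open>O((3 / 2) ^ N)\<close>, so after division by \<open>d ^ N\<close> the sum tends to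
  \<open>1 / (d - 1) ^ p\<close> (\<open>free_sum_limit\<close>).
\<close>

section \<open>Linear maps and traces\<close>

lemma clinearI:
  assumes "\<And>x y. f (x + y) = f x + f y" and "\<And>c x. f (c *\<^sub>C x) = c *\<^sub>C f x"
  shows "clinear (f :: 'a::complex_vector \<Rightarrow> 'b::complex_vector)"
  by (simp add: Vector_Spaces.linear_iff complex_vector.vector_space_axioms assms)

lemma clinear_add: "clinear f \<Longrightarrow> f (x + y) = f x + f y"
  and clinear_scaleC: "clinear f \<Longrightarrow> f (c *\<^sub>C x) = c *\<^sub>C f x"
  by (simp_all add: Vector_Spaces.linear_iff)

lemma clinear_zero: "clinear f \<Longrightarrow> f 0 = 0"
  using clinear_add[of f 0 0] by simp

lemma clinear_sum: "clinear f \<Longrightarrow> f (\<Sum>i\<in>I. g i) = (\<Sum>i\<in>I. f (g i))"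
  by (induction I rule: infinite_finite_induct) (simp_all add: clinear_zero clinear_add)

lemma clinear_comp: "clinear f \<Longrightarrow> clinear g \<Longrightarrow> clinear (f \<circ> g)"
  by (rule clinearI) (simp_all add: clinear_add clinear_scaleC)

lemma clinear_id: "clinear id"
  by (rule clinearI) simp_all

lemma clinear_eval: "clinear (\<lambda>u :: 'b \<Rightarrow> complex. u x)"
  by (rule clinearI) (simp_all add: scaleC_fun_def)

lemma sum_fun_apply: "(\<Sum>i\<in>I. f i) x = (\<Sum>i\<in>I. f i x)"
  by (induction I rule: infinite_finite_induct) simp_all

lemma clinear_sum_fun:
  "(\<And>i. i \<in> I \<Longrightarrow> clinear (T i)) \<Longrightarrow> clinear (\<lambda>u. \<Sum>i\<in>I. T i u)"
  by (rule clinearI)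
    (simp_all add: clinear_add clinear_scaleC sum.distrib complex_vector.scale_sum_right)

text \<open>The trace is defined through an unspecified basis \<open>B\<close>. Any finite resolution of the identity
  computes it, even a linearly dependent one: expand both \<open>T b\<close> in the vectors \<open>f i\<close> and \<open>f i\<close> in
  the basis \<open>B\<close>, and interchange the two sums.\<close>

lemma trace_on_resolution:
  fixes f :: "'i \<Rightarrow> 'v::complex_vector" and \<phi> :: "'i \<Rightarrow> 'v \<Rightarrow> complex"
  assumes I: "finite I" and V: "complex_vector.subspace V"
    and f: "\<And>i. i \<in> I \<Longrightarrow> f i \<in> V"
    and \<phi>: "\<And>i. i \<in> I \<Longrightarrow> clinear (\<phi> i)"
    and resolution: "\<And>u. u \<in> V \<Longrightarrow> u = (\<Sum>i\<in>I. \<phi> i u *\<^sub>C f i)"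
    and T: "clinear T" and TV: "\<And>u. u \<in> V \<Longrightarrow> T u \<in> V"
  shows "trace_on V T = (\<Sum>i\<in>I. \<phi> i (T (f i)))"
proof -
  define B where "B = (SOME B. complex_vector.independent B \<and> complex_vector.span B = V)"
  have "\<exists>B. complex_vector.independent B \<and> complex_vector.span B = V"
  proof -
    obtain B where "B \<subseteq> V" "complex_vector.independent B" "V \<subseteq> complex_vector.span B"
      using complex_vector.maximal_independent_subset by blast
    moreover from this V have "complex_vector.span B \<subseteq> V"
      by (intro complex_vector.span_minimal)
    ultimately show ?thesis by blast
  qed
  then have B: "complex_vector.independent B" "complex_vector.span B = V"
    unfolding B_def by (rule someI2_ex, blast)+
  have BV: "b \<in> V" if "b \<in> B" for b
    using complex_vector.span_base[OF that] B(2) by simp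
  have "V \<subseteq> complex_vector.span (f ` I)"
  proof
    fix u assume "u \<in> V"
    then have "u = (\<Sum>i\<in>I. \<phi> i u *\<^sub>C f i)" by (rule resolution)
    also have "\<dots> \<in> complex_vector.span (f ` I)"
      by (intro complex_vector.span_sum complex_vector.span_scale complex_vector.span_base) simp
    finally show "u \<in> complex_vector.span (f ` I)" .
  qed
  then have fin: "finite B"
    using complex_vector.independent_span_bound[of "f ` I" B] I B(1) BV by blast
  let ?r = "complex_vector.representation B"
  have r: "?r (T b) b = (\<Sum>i\<in>I. \<phi> i (T b) * ?r (f i) b)" if "b \<in> B" for b
  proof -
    have "?r (T b) = ?r (\<Sum>i\<in>I. \<phi> i (T b) *\<^sub>C f i)"
      using resolution[OF TV[OF BV[OF that]]] by simp
    also have "\<dots> = (\<lambda>b'. \<Sum>i\<in>I. ?r (\<phi> i (T b) *\<^sub>C f i) b')"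
      by (rule complex_vector.representation_sum)
        (use B f V in \<open>auto intro: complex_vector.subspace_scale\<close>)
    also have "\<dots> = (\<lambda>b'. \<Sum>i\<in>I. \<phi> i (T b) * ?r (f i) b')"
      by (intro ext sum.cong refl, subst complex_vector.representation_scale) (use B f in auto)
    finally show ?thesis by simp
  qed
  have "trace_on V T = (\<Sum>b\<in>B. ?r (T b) b)"
    by (simp add: trace_on_def B_def[symmetric])
  also have "\<dots> = (\<Sum>b\<in>B. \<Sum>i\<in>I. \<phi> i (T b) * ?r (f i) b)"
    using r by simp
  also have "\<dots> = (\<Sum>i\<in>I. \<Sum>b\<in>B. \<phi> i (T b) * ?r (f i) b)"
    by (rule sum.swap)
  also have "\<dots> = (\<Sum>i\<in>I. \<phi> i (T (f i)))"
  proof (rule sum.cong[OF refl])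
    fix i assume i: "i \<in> I"
    have "f i = (\<Sum>b\<in>B. ?r (f i) b *\<^sub>C b)"
      using complex_vector.sum_representation_eq[OF B(1) _ fin, of "f i"] f[OF i] B(2) by simp
    then have "\<phi> i (T (f i)) = \<phi> i (T (\<Sum>b\<in>B. ?r (f i) b *\<^sub>C b))" by simp
    also have "\<dots> = (\<Sum>b\<in>B. ?r (f i) b * \<phi> i (T b))"
      by (simp add: clinear_sum[OF T] clinear_sum[OF \<phi>[OF i]] clinear_scaleC[OF T]
          clinear_scaleC[OF \<phi>[OF i]] scaleC_complex_def)
    finally show "(\<Sum>b\<in>B. \<phi> i (T b) * ?r (f i) b) = \<phi> i (T (f i))"
      by (simp add: mult.commute)
  qed
  finally show ?thesis .
qed

section \<open>Orthonormal bases and rank-one projections\<close>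

lemma cinner_zero_right [simp]: "cinner x 0 = 0"
  using cinner_add_right[of x 0 0] by simp

lemma cinner_scaleC_left: "cinner (c *\<^sub>C x) y = cnj c * cinner x y"
  by (metis cinner_scaleC_right cinner_commute complex_cnj_mult)

lemma cinner_diff_right: "cinner x (y - z) = cinner x y - cinner x z"
  using cinner_add_right[of x "y - z" z] by simp

lemma cinner_sum_right: "cinner x (\<Sum>i\<in>I. f i) = (\<Sum>i\<in>I. cinner x (f i))"
  by (induction I rule: infinite_finite_induct) (simp_all add: cinner_add_right)

lemma cinner_self_real: "cinner x x = of_real (Re (cinner x x))"
  by (metis cinner_commute Reals_cnj_iff of_real_Re)

definition orthonormal :: "'a::complex_inner set \<Rightarrow> bool"
  where "orthonormal E \<longleftrightarrow> (\<forall>x\<in>E. \<forall>y\<in>E. cinner x y = (if x = y then 1 else 0))"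

lemma orthonormal_expansion_cinner:
  assumes "finite E" "orthonormal E" "e \<in> E"
  shows "cinner e (\<Sum>x\<in>E. c x *\<^sub>C x) = c e"
proof -
  have "cinner e (\<Sum>x\<in>E. c x *\<^sub>C x) = (\<Sum>x\<in>E. c x * cinner e x)"
    by (simp add: cinner_sum_right cinner_scaleC_right)
  also have "\<dots> = (\<Sum>x\<in>E. if x = e then c e else 0)"
    by (rule sum.cong) (use assms in \<open>auto simp: orthonormal_def\<close>)
  finally show ?thesis using assms by simp
qed

lemma orthonormal_independent:
  assumes "finite E" "orthonormal E"
  shows "complex_vector.independent E"
proof (rule complex_vector.independent_if_scalars_zero[OF assms(1)])
  fix c e assume "(\<Sum>x\<in>E. c x *\<^sub>C x) = 0" "e \<in> E"
  then show "c e = 0" using orthonormal_expansion_cinner[OF assms, of e c] by simp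
qed

lemma gram_schmidt:
  assumes "finite S"
  shows "\<exists>E. finite E \<and> orthonormal E \<and> S \<subseteq> complex_vector.span E"
  using assms
proof induction
  case empty
  show ?case by (intro exI[of _ "{}"]) (simp add: orthonormal_def)
next
  case (insert v S)
  then obtain E where E: "finite E" "orthonormal E" "S \<subseteq> complex_vector.span E" by blast
  \<comment> \<open>Remove from \<open>v\<close> its projection onto the span of \<open>E\<close>; if the remainder is zero, \<open>E\<close> already
    spans \<open>v\<close>, and otherwise the normalised remainder is the new basis vector.\<close>
  define p where "p = (\<Sum>e\<in>E. cinner e v *\<^sub>C e)"
  define w where "w = v - p"
  have p: "p \<in> complex_vector.span E"
    unfolding p_def
    by (intro complex_vector.span_sum complex_vector.span_scale complex_vector.span_base)
  have v: "v = p + w" by (simp add: w_def)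
  have Ew: "cinner e w = 0" if "e \<in> E" for e
    using orthonormal_expansion_cinner[OF E(1,2) that, of "\<lambda>e. cinner e v"]
    by (simp add: w_def p_def cinner_diff_right)
  show ?case
  proof (cases "w = 0")
    case True
    then show ?thesis using E p v by auto
  next
    case False
    define n where "n = sqrt (Re (cinner w w))"
    have n: "n > 0" and n2: "cinner w w = of_real n * of_real n"
      using cinner_pos[OF False] cinner_self_real[of w]
      by (auto simp: n_def simp flip: of_real_mult)
    define u where "u = (1 / complex_of_real n) *\<^sub>C w"
    have w: "w = complex_of_real n *\<^sub>C u"
      using n by (simp add: u_def scaleC_scaleC scaleC_one)
    have uu: "cinner u u = 1"
      using n by (simp add: u_def cinner_scaleC_left cinner_scaleC_right n2)
    have Eu: "cinner e u = 0" "cinner u e = 0" if "e \<in> E" for e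
    proof -
      show "cinner e u = 0" using Ew[OF that] by (simp add: u_def cinner_scaleC_right)
      then show "cinner u e = 0" by (subst cinner_commute) simp
    qed
    have "orthonormal (insert u E)"
      using E(2) uu Eu by (force simp: orthonormal_def)
    moreover have "v \<in> complex_vector.span (insert u E)"
      unfolding v w
    proof (rule complex_vector.span_add)
      show "p \<in> complex_vector.span (insert u E)"
        using p complex_vector.span_mono[of E "insert u E"] by blast
      show "complex_of_real n *\<^sub>C u \<in> complex_vector.span (insert u E)"
        by (intro complex_vector.span_scale complex_vector.span_base) simp
    qed
    moreover have "S \<subseteq> complex_vector.span (insert u E)"
      using E(3) complex_vector.span_mono[of E "insert u E"] by blast
    ultimately show ?thesis using E(1) by (intro exI[of _ "insert u E"]) auto
  qed
qed

lemma orthonormal_basis_exists: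
  assumes "complex_vector.dim (UNIV :: 'a::complex_inner set) = d" and "d > 0"
  obtains E :: "'a::complex_inner set" where "finite E" "orthonormal E" "card E = d"
    "\<And>x. x = (\<Sum>e\<in>E. cinner e x *\<^sub>C e)"
proof -
  obtain B :: "'a set" where B: "complex_vector.independent B" "UNIV \<subseteq> complex_vector.span B"
    using complex_vector.maximal_independent_subset[of UNIV] by blast
  then have "card B = d"
    using complex_vector.basis_card_eq_dim[of B UNIV] assms by simp
  then have "finite B" using assms(2) card_gt_0_iff by blast
  then obtain E where E: "finite E" "orthonormal E" "B \<subseteq> complex_vector.span E"
    using gram_schmidt by blast
  have span: "complex_vector.span E = UNIV"
    using B(2) complex_vector.span_minimal[OF E(3)] by auto
  have "card E = d"
    using complex_vector.basis_card_eq_dim[of E UNIV] orthonormal_independent[OF E(1,2)] span assms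
    by simp
  moreover have "x = (\<Sum>e\<in>E. cinner e x *\<^sub>C e)" for x
  proof -
    obtain c where c: "x = (\<Sum>e\<in>E. c e *\<^sub>C e)"
      using complex_vector.span_finite[OF E(1)] span by auto
    show ?thesis
      using orthonormal_expansion_cinner[OF E(1,2), of _ c] by (simp add: c)
  qed
  ultimately show ?thesis using that E by blast
qed

lemma orth_proj_unit:
  assumes "cinner \<xi> \<xi> = 1"
  shows "orth_proj (complex_vector.span {\<xi>}) x = cinner \<xi> x *\<^sub>C \<xi>"
  unfolding orth_proj_def
proof (rule the_equality)
  show "cinner \<xi> x *\<^sub>C \<xi> \<in> complex_vector.span {\<xi>} \<and>
    (\<forall>v\<in>complex_vector.span {\<xi>}. cinner v (x - cinner \<xi> x *\<^sub>C \<xi>) = 0)"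
    using assms
    by (auto simp: complex_vector.span_singleton cinner_scaleC_left cinner_scaleC_right
        cinner_diff_right)
next
  fix y assume y: "y \<in> complex_vector.span {\<xi>} \<and> (\<forall>v\<in>complex_vector.span {\<xi>}. cinner v (x - y) = 0)"
  then obtain c where c: "y = c *\<^sub>C \<xi>" by (auto simp: complex_vector.span_singleton)
  have "cinner \<xi> (x - y) = 0" using y complex_vector.span_base[of \<xi> "{\<xi>}"] by simp
  then show "y = cinner \<xi> x *\<^sub>C \<xi>"
    using assms by (simp add: c cinner_diff_right cinner_scaleC_right)
qed

section \<open>Tensor powers\<close>

lemma selfadjoint_id: "selfadjoint id"
  by (simp add: selfadjoint_def clinear_id)

lemma selfadjoint_rank_one: "selfadjoint (\<lambda>x. cinner \<xi> x *\<^sub>C \<xi>)"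
  unfolding selfadjoint_def
proof (intro conjI allI clinearI)
  fix x y
  show "cinner (cinner \<xi> x *\<^sub>C \<xi>) y = cinner x (cinner \<xi> y *\<^sub>C \<xi>)"
    by (simp add: cinner_scaleC_left cinner_scaleC_right cinner_commute[of x \<xi>])
qed (simp_all add: cinner_add_right cinner_scaleC_right scaleC_add_left scaleC_scaleC)

text \<open>The tensor product of operators exists on the space of all forms, by composing a form with the
  adjoints: \<open>\<langle>y1, T1 x1\<rangle> ... \<langle>yN, TN xN\<rangle> = \<langle>T1\<^sup>* y1, x1\<rangle> ... \<langle>TN\<^sup>* yN, xN\<rangle>\<close>. For self-adjoint
  factors this is composition with the factors themselves, so the choice in the definition of
  \<^const>\<open>tensor_op\<close> has a witness.\<close>

lemma tensor_op_selfadjoint: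
  assumes "\<And>A. A \<in> set Ts \<Longrightarrow> selfadjoint A"
  shows clinear_tensor_op: "clinear (tensor_op Ts)"
    and tensor_op_elem_tensor: "\<And>xs. length xs = length Ts \<Longrightarrow>
      tensor_op Ts (elem_tensor xs) = elem_tensor (map2 (\<lambda>A x. A x) Ts xs)"
proof -
  define T :: "('a list \<Rightarrow> complex) \<Rightarrow> 'a list \<Rightarrow> complex" where
    "T u = (\<lambda>ys. if length ys = length Ts then u (map2 (\<lambda>A x. A x) Ts ys) else 0)" for u
  have "clinear T"
    by (rule clinearI) (auto simp: T_def scaleC_fun_def scaleC_complex_def fun_eq_iff)
  moreover have "T (elem_tensor xs) = elem_tensor (map2 (\<lambda>A x. A x) Ts xs)"
    if "length xs = length Ts" for xs
    using that assms by (auto simp: T_def elem_tensor_def fun_eq_iff selfadjoint_def intro!: prod.cong)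
  ultimately have "\<exists>T. clinear T \<and> (\<forall>xs. length xs = length Ts \<longrightarrow>
      T (elem_tensor xs) = elem_tensor (map2 (\<lambda>A x. A x) Ts xs))"
    by blast
  from someI_ex[OF this]
  show "clinear (tensor_op Ts)" "\<And>xs. length xs = length Ts \<Longrightarrow>
      tensor_op Ts (elem_tensor xs) = elem_tensor (map2 (\<lambda>A x. A x) Ts xs)"
    unfolding tensor_op_def by blast+
qed

lemma sum_lists_length_Suc:
  "(\<Sum>xs | set xs \<subseteq> A \<and> length xs = Suc n. g xs) =
    (\<Sum>x\<in>A. \<Sum>xs | set xs \<subseteq> A \<and> length xs = n. g (x # xs))"
proof -
  have "(\<Sum>xs | set xs \<subseteq> A \<and> length xs = Suc n. g xs) =
      (\<Sum>(x, xs)\<in>A \<times> {xs. set xs \<subseteq> A \<and> length xs = n}. g (x # xs))"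
    by (rule sum.reindex_bij_witness[of _ "\<lambda>(x, xs). x # xs" "\<lambda>xs. (hd xs, tl xs)"])
      (auto simp: length_Suc_conv)
  then show ?thesis by (simp add: sum.cartesian_product)
qed

lemma sum_lists_prod:
  "(\<Sum>xs | set xs \<subseteq> A \<and> length xs = n. \<Prod>i<n. f i (xs ! i)) =
    (\<Prod>i<n. \<Sum>x\<in>A. f i x :: 'b::comm_semiring_1)"
proof (induction n arbitrary: f)
  case 0
  have "{xs. set xs \<subseteq> A \<and> length xs = 0} = {[]}" by auto
  then show ?case by simp
next
  case (Suc n)
  show ?case
    using Suc[of "\<lambda>i. f (Suc i)"]
    by (simp add: sum_lists_length_Suc prod.lessThan_Suc_shift del: prod.lessThan_Suc
        flip: sum_distrib_left sum_distrib_right)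
qed

text \<open>A finite Parseval frame, for instance an orthonormal basis. The expansion property is what makes
  evaluation at the frame vectors a resolution of the identity.\<close>

locale finite_frame =
  fixes E :: "'a::complex_inner set"
  assumes finite_frame: "finite E"
    and frame_expansion: "x = (\<Sum>e\<in>E. cinner e x *\<^sub>C e)"
begin

definition frame_trace :: "('a \<Rightarrow> 'a) \<Rightarrow> complex"
  where "frame_trace A = (\<Sum>e\<in>E. cinner e (A e))"

lemma frame_parseval: "(\<Sum>e\<in>E. cinner e x * cinner y e) = cinner y x"
  by (subst (2) frame_expansion[of x]) (simp add: cinner_sum_right cinner_scaleC_right)

lemma frame_trace_id: "frame_trace id = (\<Sum>e\<in>E. cinner e e)"
  by (simp add: frame_trace_def)

lemma frame_trace_rank_one: "frame_trace (\<lambda>x. cinner \<xi> x *\<^sub>C \<xi>) = cinner \<xi> \<xi>"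
  by (simp add: frame_trace_def cinner_scaleC_right frame_parseval mult.commute[of "cinner \<xi> _"])

lemma elem_tensor_expansion:
  assumes "length xs = N"
  shows "elem_tensor xs =
    (\<Sum>es | set es \<subseteq> E \<and> length es = N. elem_tensor xs es *\<^sub>C elem_tensor es)"
proof
  fix ys :: "'a list"
  let ?I = "{es. set es \<subseteq> E \<and> length es = N}"
  have "(\<Sum>es\<in>?I. elem_tensor xs es *\<^sub>C elem_tensor es) ys =
      (\<Sum>es\<in>?I. elem_tensor xs es * elem_tensor es ys)"
    by (simp add: sum_fun_apply scaleC_fun_def scaleC_complex_def)
  also have "\<dots> = elem_tensor xs ys"
  proof (cases "length ys = N")
    case True
    have "(\<Sum>es\<in>?I. elem_tensor xs es * elem_tensor es ys) =
        (\<Sum>es\<in>?I. \<Prod>i<N. cinner (es ! i) (xs ! i) * cinner (ys ! i) (es ! i))"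
      by (rule sum.cong) (auto simp: elem_tensor_def assms True prod.distrib)
    also have "\<dots> = (\<Prod>i<N. cinner (ys ! i) (xs ! i))"
      by (subst sum_lists_prod) (simp add: frame_parseval)
    finally show ?thesis by (simp add: elem_tensor_def assms True)
  qed (simp add: elem_tensor_def assms)
  finally show "elem_tensor xs ys = (\<Sum>es\<in>?I. elem_tensor xs es *\<^sub>C elem_tensor es) ys" by simp
qed

text \<open>Evaluating a form at the frame vectors gives its coefficients with respect to their elementary
  tensors; this resolution of the identity of the tensor power reduces its trace to values of forms.\<close>

lemma tensor_power_expansion:
  assumes "u \<in> tensor_power N"
  shows "u = (\<Sum>es | set es \<subseteq> E \<and> length es = N. u es *\<^sub>C elem_tensor es)"
  using assms unfolding tensor_power_def
proof (induction rule: complex_vector.span_induct_alt)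
  case base
  show ?case by simp
next
  case (step c x y)
  let ?I = "{es. set es \<subseteq> E \<and> length es = N}"
  from step obtain xs where "x = elem_tensor xs" "length xs = N" by blast
  then have "x = (\<Sum>es\<in>?I. x es *\<^sub>C elem_tensor es)" using elem_tensor_expansion[of xs] by blast
  then have "c *\<^sub>C x + y = c *\<^sub>C (\<Sum>es\<in>?I. x es *\<^sub>C elem_tensor es)
      + (\<Sum>es\<in>?I. y es *\<^sub>C elem_tensor es)"
    using step(2) by (rule arg_cong2[of _ _ _ _ "\<lambda>u v. c *\<^sub>C u + v"])
  also have "\<dots> = (\<Sum>es\<in>?I. (c * x es + y es) *\<^sub>C elem_tensor es)"
    by (simp add: complex_vector.scale_sum_right scaleC_scaleC scaleC_add_left sum.distrib)
  also have "\<dots> = (\<Sum>es\<in>?I. (c *\<^sub>C x + y) es *\<^sub>C elem_tensor es)"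
    by (simp add: scaleC_fun_def[of c x] scaleC_complex_def)
  finally show ?case .
qed

lemma tensor_trace_frame:
  assumes T: "clinear T"
    and T_elem: "\<And>xs. length xs = N \<Longrightarrow> T (elem_tensor xs) \<in> tensor_power N"
  shows "tensor_trace N T = (\<Sum>es | set es \<subseteq> E \<and> length es = N. T (elem_tensor es) es)"
  unfolding tensor_trace_def
proof (rule trace_on_resolution[where \<phi> = "\<lambda>es u. u es"])
  show "T u \<in> tensor_power N" if "u \<in> tensor_power N" for u
    using that unfolding tensor_power_def
  proof (induction rule: complex_vector.span_induct_alt)
    case base
    show ?case by (subst clinear_zero[OF T]) (rule complex_vector.span_zero)
  next
    case (step c x y)
    then obtain xs where "x = elem_tensor xs" "length xs = N" by blast
    then have "T x \<in> complex_vector.span (elem_tensor ` {xs. length xs = N})"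
      using T_elem[of xs] by (simp add: tensor_power_def)
    then have "c *\<^sub>C T x + T y \<in> complex_vector.span (elem_tensor ` {xs. length xs = N})"
      using step by (intro complex_vector.span_add complex_vector.span_scale)
    then show ?case unfolding clinear_add[OF T] clinear_scaleC[OF T] .
  qed
  show "finite {es. set es \<subseteq> E \<and> length es = N}"
    using finite_frame by (rule finite_lists_length_eq)
  show "complex_vector.subspace (tensor_power N)"
    by (simp add: tensor_power_def)
  show "elem_tensor es \<in> tensor_power N" if "es \<in> {es. set es \<subseteq> E \<and> length es = N}" for es :: "'a list"
    using that by (simp add: tensor_power_def complex_vector.span_base)
  show "clinear (\<lambda>u :: 'a list \<Rightarrow> complex. u es)" for es by (rule clinear_eval)
qed (use tensor_power_expansion T in auto)

lemma tensor_trace_product: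
  assumes T: "clinear T"
    and T_elem: "\<And>xs. length xs = N \<Longrightarrow>
      T (elem_tensor xs) = elem_tensor (map (\<lambda>i. C i (xs ! i)) [0..<N])"
  shows "tensor_trace N T = (\<Prod>i<N. frame_trace (C i))"
proof -
  have "tensor_trace N T = (\<Sum>es | set es \<subseteq> E \<and> length es = N. T (elem_tensor es) es)"
    using T by (rule tensor_trace_frame)
      (simp add: T_elem tensor_power_def complex_vector.span_base)
  also have "\<dots> = (\<Sum>es | set es \<subseteq> E \<and> length es = N. \<Prod>i<N. cinner (es ! i) (C i (es ! i)))"
  proof (rule sum.cong[OF refl])
    fix es assume "es \<in> {es. set es \<subseteq> E \<and> length es = N}"
    then have es: "length es = N" by simp
    show "T (elem_tensor es) es = (\<Prod>i<N. cinner (es ! i) (C i (es ! i)))"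
      unfolding T_elem[OF es] by (simp add: elem_tensor_def es)
  qed
  also have "\<dots> = (\<Prod>i<N. frame_trace (C i))"
    unfolding frame_trace_def by (rule sum_lists_prod)
  finally show ?thesis .
qed

lemma tensor_trace_sum:
  fixes T :: "'i \<Rightarrow> ('a list \<Rightarrow> complex) \<Rightarrow> 'a list \<Rightarrow> complex"
  assumes T: "\<And>i. i \<in> I \<Longrightarrow> clinear (T i)"
    and T_elem: "\<And>i xs. i \<in> I \<Longrightarrow> length xs = N \<Longrightarrow> T i (elem_tensor xs) \<in> tensor_power N"
  shows "tensor_trace N (\<lambda>u. \<Sum>i\<in>I. T i u) = (\<Sum>i\<in>I. tensor_trace N (T i))"
proof -
  let ?L = "{es. set es \<subseteq> E \<and> length es = N}"
  have "tensor_trace N (\<lambda>u. \<Sum>i\<in>I. T i u) = (\<Sum>es\<in>?L. (\<Sum>i\<in>I. T i (elem_tensor es)) es)"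
  proof (rule tensor_trace_frame[OF clinear_sum_fun[OF T]])
    show "(\<Sum>i\<in>I. T i (elem_tensor xs)) \<in> tensor_power N" if "length xs = N" for xs
      using T_elem[OF _ that] unfolding tensor_power_def by (rule complex_vector.span_sum)
  qed
  also have "\<dots> = (\<Sum>i\<in>I. \<Sum>es\<in>?L. T i (elem_tensor es) es)"
    by (simp add: sum_fun_apply sum.swap[of _ I])
  also have "\<dots> = (\<Sum>i\<in>I. tensor_trace N (T i))"
    by (rule sum.cong) (simp_all add: tensor_trace_frame[OF T T_elem])
  finally show ?thesis .
qed

end

section \<open>Sums over words by relative order\<close>

lemma sum_lists_range_relabel:
  fixes weight :: "nat list \<Rightarrow> 'b::comm_monoid_add"
  assumes weight: "\<And>h js. strict_mono_on (set js) h \<Longrightarrow> weight (map h js) = weight js"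
    and R: "finite R" "card R = p"
  shows "(\<Sum>is | length is = k \<and> set is = R. weight is) =
    (\<Sum>js | length js = k \<and> set js = {1..p}. weight js)"
proof -
  obtain g where g: "bij_betw g {..<p} R" "strict_mono_on {..<p} g"
    using ex_bij_betw_strict_mono_card[OF R(1)] R(2) by blast
  define h where "h j = g (j - 1)" for j
  have "strict_mono_on {1..p} h"
    by (intro strict_mono_onI) (auto simp: h_def intro!: strict_mono_onD[OF g(2)])
  then have h: "strict_mono_on {1..p} h" "inj_on h {1..p}"
    by (auto dest: strict_mono_on_imp_inj_on)
  have img: "h ` {1..p} = R"
  proof -
    have "h ` {1..p} = g ` ((\<lambda>j. j - 1) ` {1..p})" by (simp add: h_def image_image)
    also have "(\<lambda>j. j - 1) ` {1..p} = {..<p}"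
      by (force simp: image_iff intro: bexI[of _ "Suc _"])
    finally show ?thesis using g(1) by (simp add: bij_betw_def)
  qed
  let ?h' = "the_inv_into {1..p} h"
  show ?thesis
  proof (rule sum.reindex_bij_witness[of _ "map h" "map ?h'"])
    fix xs assume xs: "xs \<in> {is. length is = k \<and> set is = R}"
    then have "h (?h' x) = x" if "x \<in> set xs" for x
      using f_the_inv_into_f[OF h(2), of x] img that by simp
    then show inverse: "map h (map ?h' xs) = xs" by (simp add: map_idI)
    have "?h' ` R = {1..p}"
      using the_inv_into_onto[OF h(2)] img by simp
    then show *: "map ?h' xs \<in> {js. length js = k \<and> set js = {1..p}}"
      using xs by simp
    have "weight xs = weight (map h (map ?h' xs))"
      using inverse by simp
    also have "\<dots> = weight (map ?h' xs)"
      using * h(1) by (intro weight) simp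
    finally show "weight (map ?h' xs) = weight xs" ..
  next
    fix js assume js: "js \<in> {js. length js = k \<and> set js = {1..p}}"
    then have "?h' (h j) = j" if "j \<in> set js" for j
      using the_inv_into_f_f[OF h(2), of j] that by simp
    then show "map ?h' (map h js) = js" by (simp add: map_idI)
    show "map h js \<in> {is. length is = k \<and> set is = R}" using js img by simp
  qed
qed

text \<open>An order-invariant weight sees a word only through its pattern, that is, the word over
  \<open>{1..p}\<close> obtained by numbering the \<open>p\<close> letters that occur in increasing order. A word is the
  same as the set of its letters together with its pattern, so the two can be summed independently.\<close>

lemma sum_lists_by_pattern:
  fixes weight :: "nat list \<Rightarrow> 'b::comm_semiring_1" and f :: "nat set \<Rightarrow> 'b"
  assumes weight: "\<And>h js. strict_mono_on (set js) h \<Longrightarrow> weight (map h js) = weight js"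
  shows "(\<Sum>is | set is \<subseteq> {1..N} \<and> length is = k. f (set is) * weight is) =
    (\<Sum>p\<le>k. (\<Sum>R | R \<subseteq> {1..N} \<and> card R = p. f R) *
      (\<Sum>js | length js = k \<and> set js = {1..p}. weight js))"
proof -
  let ?L = "{is. set is \<subseteq> {1..N} \<and> length is = k}"
  have fin: "finite ?L" by (rule finite_lists_length_eq) simp
  have "(\<Sum>is\<in>?L. f (set is) * weight is) =
      (\<Sum>p\<le>k. \<Sum>is | is \<in> ?L \<and> card (set is) = p. f (set is) * weight is)"
    using fin card_length by (intro sum.group[symmetric]) auto
  also have "\<dots> = (\<Sum>p\<le>k. (\<Sum>R | R \<subseteq> {1..N} \<and> card R = p. f R) *
      (\<Sum>js | length js = k \<and> set js = {1..p}. weight js))"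
  proof (rule sum.cong[OF refl])
    fix p assume "p \<in> {..k}"
    let ?R = "{R. R \<subseteq> {1..N} \<and> card R = p}"
    have "(\<Sum>is | is \<in> ?L \<and> card (set is) = p. f (set is) * weight is) =
        (\<Sum>R\<in>?R. \<Sum>is | is \<in> {is. is \<in> ?L \<and> card (set is) = p} \<and> set is = R. f (set is) * weight is)"
    proof (rule sum.group[symmetric])
      show "finite {is. is \<in> ?L \<and> card (set is) = p}"
        by (rule finite_subset[OF _ fin]) blast
      show "finite ?R" by (rule finite_subset[of _ "Pow {1..N}"]) auto
    qed auto
    also have "\<dots> = (\<Sum>R\<in>?R. f R * (\<Sum>is | length is = k \<and> set is = R. weight is))"
    proof (rule sum.cong[OF refl])
      fix R assume "R \<in> ?R"
      then have "{is. is \<in> {is. is \<in> ?L \<and> card (set is) = p} \<and> set is = R} =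
          {is. length is = k \<and> set is = R}"
        by auto
      then show "(\<Sum>is | is \<in> {is. is \<in> ?L \<and> card (set is) = p} \<and> set is = R. f (set is) * weight is) =
          f R * (\<Sum>is | length is = k \<and> set is = R. weight is)"
        by (simp add: sum_distrib_left)
    qed
    also have "\<dots> = (\<Sum>R\<in>?R. f R * (\<Sum>js | length js = k \<and> set js = {1..p}. weight js))"
      by (rule sum.cong[OF refl], subst sum_lists_range_relabel[where p = p])
        (auto simp: weight intro: finite_subset)
    finally show "(\<Sum>is | is \<in> ?L \<and> card (set is) = p. f (set is) * weight is) =
        (\<Sum>R\<in>?R. f R) * (\<Sum>js | length js = k \<and> set js = {1..p}. weight js)"
      by (simp add: sum_distrib_right)
  qed
  finally show ?thesis .
qed

section \<open>The contribution of the free legs\<close>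

text \<open>The number of legs that precede all the legs in \<open>R\<close>. For \<open>R = {}\<close> these are all \<open>N\<close> legs, the
  value for which the recursion below starts correctly at \<open>p = 0\<close>.\<close>

definition free_legs :: "nat \<Rightarrow> nat set \<Rightarrow> nat"
  where "free_legs N R = card {j \<in> {1..N}. \<forall>r\<in>R. j < r}"

definition free_sum :: "real \<Rightarrow> nat \<Rightarrow> nat \<Rightarrow> real"
  where "free_sum d p N = (\<Sum>R | R \<subseteq> {1..N} \<and> card R = p. d ^ free_legs N R)"

lemma free_sum_0: "free_sum d 0 N = d ^ N"
proof -
  have "{R. R \<subseteq> {1..N} \<and> card R = 0} = {{}}"
    by (auto dest: finite_subset)
  moreover have "{j \<in> {1..N}. \<forall>r\<in>{}. j < r} = {1..N}" by auto
  ultimately show ?thesis unfolding free_sum_def free_legs_def by simp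
qed

lemma free_sum_Suc_0: "free_sum d (Suc p) 0 = 0"
  by (auto simp: free_sum_def intro!: sum.neutral)

text \<open>Split the subsets by whether they contain \<open>Suc N\<close>. Neither joining that element to a subset of
  \<open>{1..N}\<close> nor, for a non-empty subset, adding it as a further leg changes the free legs.\<close>

lemma free_sum_Suc_Suc: "free_sum d (Suc p) (Suc N) = free_sum d (Suc p) N + free_sum d p N"
proof -
  let ?S = "\<lambda>p. {R. R \<subseteq> {1..N} \<and> card R = p}"
  have fin: "finite R" if "R \<subseteq> {1..N}" for R using that by (rule finite_subset) simp
  have notin: "Suc N \<notin> R" if "R \<subseteq> {1..N}" for R using that by auto
  have "{R. R \<subseteq> {1..Suc N} \<and> card R = Suc p} = ?S (Suc p) \<union> insert (Suc N) ` ?S p"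
  proof (intro equalityI subsetI)
    fix R assume R: "R \<in> {R. R \<subseteq> {1..Suc N} \<and> card R = Suc p}"
    show "R \<in> ?S (Suc p) \<union> insert (Suc N) ` ?S p"
    proof (cases "Suc N \<in> R")
      case True
      have "R - {Suc N} \<in> ?S p" using R True by (auto simp: le_Suc_eq)
      moreover have "R = insert (Suc N) (R - {Suc N})" using True by auto
      ultimately show ?thesis by blast
    next
      case False
      then show ?thesis using R by (auto simp: le_Suc_eq)
    qed
  next
    fix R assume "R \<in> ?S (Suc p) \<union> insert (Suc N) ` ?S p"
    then consider "R \<in> ?S (Suc p)" | R' where "R' \<in> ?S p" "R = insert (Suc N) R'"
      by blast
    then show "R \<in> {R. R \<subseteq> {1..Suc N} \<and> card R = Suc p}"
    proof cases
      case 1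
      have "{1..N} \<subseteq> {1..Suc N}" by simp
      then show ?thesis using 1 by blast
    next
      case 2
      then have "card R = Suc p" using fin[of R'] notin[of R'] by simp
      moreover have "{1..Suc N} = insert (Suc N) {1..N}" by auto
      ultimately show ?thesis using 2 by blast
    qed
  qed
  moreover have "?S (Suc p) \<inter> insert (Suc N) ` ?S p = {}" using notin by blast
  moreover have "finite (?S q)" for q by (rule finite_subset[of _ "Pow {1..N}"]) auto
  ultimately have "free_sum d (Suc p) (Suc N) =
      (\<Sum>R\<in>?S (Suc p). d ^ free_legs (Suc N) R) +
      (\<Sum>R\<in>insert (Suc N) ` ?S p. d ^ free_legs (Suc N) R)"
    by (simp add: free_sum_def sum.union_disjoint)
  also have "(\<Sum>R\<in>?S (Suc p). d ^ free_legs (Suc N) R) = free_sum d (Suc p) N"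
    unfolding free_sum_def
  proof (rule sum.cong[OF refl])
    fix R assume R: "R \<in> ?S (Suc p)"
    then have "R \<noteq> {}" by auto
    then obtain r where "r \<in> R" by blast
    moreover from this have "r \<le> N" using R by auto
    ultimately have "{j \<in> {1..Suc N}. \<forall>r\<in>R. j < r} = {j \<in> {1..N}. \<forall>r\<in>R. j < r}"
      by (force simp: le_Suc_eq)
    then show "d ^ free_legs (Suc N) R = d ^ free_legs N R" by (simp add: free_legs_def)
  qed
  also have "(\<Sum>R\<in>insert (Suc N) ` ?S p. d ^ free_legs (Suc N) R) = free_sum d p N"
  proof -
    have "inj_on (insert (Suc N)) (?S p)"
      using notin by (auto simp: inj_on_def dest!: insert_ident[THEN iffD1, rotated 2])
    moreover have "free_legs (Suc N) (insert (Suc N) R) = free_legs N R" for R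
      unfolding free_legs_def by (rule arg_cong[of _ _ card]) auto
    ultimately show ?thesis by (simp add: free_sum_def sum.reindex)
  qed
  finally show ?thesis .
qed

text \<open>The error \<open>d ^ N / (d - 1) ^ p - free_sum d p N\<close> satisfies Pascal's recursion, since both terms
  do. It vanishes for \<open>p = 0\<close> and is at most \<open>1\<close> in absolute value for \<open>N = 0\<close>. The bound is the
  solution \<open>x ^ N * y ^ p\<close> of the same recursion, \<open>x = 1 + 1 / y\<close>, at \<open>y = 2\<close>; any \<open>x\<close> below
  \<open>d\<close> makes the error negligible against \<open>d ^ N\<close>.\<close>

lemma free_sum_error:
  assumes "d \<ge> 2"
  shows "\<bar>d ^ N / (d - 1) ^ p - free_sum d p N\<bar> \<le> (3 / 2) ^ N * 2 ^ p"
proof (induction N arbitrary: p)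
  case 0
  have "1 \<le> (d - 1) ^ p" using assms by (intro one_le_power) simp
  then have "1 / (d - 1) ^ p \<le> 1" by simp
  also have "(1 :: real) \<le> 2 ^ p" by simp
  finally show ?case
    using \<open>1 \<le> (d - 1) ^ p\<close> by (cases p) (auto simp: free_sum_0 free_sum_Suc_0)
next
  case (Suc N)
  show ?case
  proof (cases p)
    case 0
    then show ?thesis by (simp add: free_sum_0)
  next
    case p: (Suc q)
    have "d ^ Suc N / (d - 1) ^ Suc q = d ^ N / (d - 1) ^ Suc q + d ^ N / (d - 1) ^ q"
      using assms by (simp add: field_simps)
    then have "\<bar>d ^ Suc N / (d - 1) ^ p - free_sum d p (Suc N)\<bar> \<le>
        \<bar>d ^ N / (d - 1) ^ Suc q - free_sum d (Suc q) N\<bar> + \<bar>d ^ N / (d - 1) ^ q - free_sum d q N\<bar>"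
      unfolding p free_sum_Suc_Suc by linarith
    also have "\<dots> \<le> (3 / 2) ^ N * 2 ^ Suc q + (3 / 2) ^ N * 2 ^ q"
      by (intro add_mono Suc)
    also have "\<dots> = (3 / 2) ^ Suc N * 2 ^ p"
      by (simp add: p)
    finally show ?thesis .
  qed
qed

lemma free_sum_limit:
  assumes "d \<ge> 2"
  shows "(\<lambda>N. free_sum d p N / d ^ N) \<longlonglongrightarrow> 1 / (d - 1) ^ p"
proof -
  have "(\<lambda>N. free_sum d p N / d ^ N - 1 / (d - 1) ^ p) \<longlonglongrightarrow> 0"
  proof (rule tendsto_0_le)
    show "(\<lambda>N. (3 / (2 * d)) ^ N) \<longlonglongrightarrow> 0"
      using assms by (intro LIMSEQ_power_zero) simp
    show "\<forall>\<^sub>F N in sequentially. norm (free_sum d p N / d ^ N - 1 / (d - 1) ^ p) \<le>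
        norm ((3 / (2 * d)) ^ N) * 2 ^ p"
    proof (rule always_eventually, rule allI)
      fix N
      have "free_sum d p N / d ^ N - 1 / (d - 1) ^ p =
          - (d ^ N / (d - 1) ^ p - free_sum d p N) / d ^ N"
        using assms by (simp add: diff_divide_distrib)
      then have "norm (free_sum d p N / d ^ N - 1 / (d - 1) ^ p) =
          \<bar>d ^ N / (d - 1) ^ p - free_sum d p N\<bar> / d ^ N"
        using assms by (simp add: abs_divide)
      also have "\<dots> \<le> ((3 / 2) ^ N * 2 ^ p) / d ^ N"
        using assms by (intro divide_right_mono free_sum_error) auto
      also have "\<dots> = norm ((3 / (2 * d)) ^ N) * 2 ^ p"
        using assms by (simp add: power_divide power_mult_distrib)
      finally show "norm (free_sum d p N / d ^ N - 1 / (d - 1) ^ p) \<le>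
        norm ((3 / (2 * d)) ^ N) * 2 ^ p" .
    qed
  qed
  then show ?thesis by (simp add: LIM_zero_iff)
qed

section \<open>Ordered set partitions as surjective words\<close>

lemma block_index_eqI:
  assumes \<pi>: "\<pi> \<in> ordered_set_partitions k" and q: "1 \<le> q" "q \<le> length \<pi>" "m \<in> \<pi> ! (q - 1)"
  shows "block_index \<pi> m = q"
  unfolding block_index_def
proof (rule the_equality)
  fix q' assume q': "1 \<le> q' \<and> q' \<le> length \<pi> \<and> m \<in> \<pi> ! (q' - 1)"
  then have "m \<in> \<pi> ! (q - 1) \<inter> \<pi> ! (q' - 1)" using q by simp
  moreover have "q - 1 < length \<pi>" "q' - 1 < length \<pi>" using q q' by auto
  ultimately have "q - 1 = q' - 1"
    using \<pi> unfolding ordered_set_partitions_def by blast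
  then show "q' = q" using q(1) q' by linarith
qed (use q in simp)

lemma block_index_mem:
  assumes \<pi>: "\<pi> \<in> ordered_set_partitions k" and m: "m \<in> {1..k}"
  shows "1 \<le> block_index \<pi> m" "block_index \<pi> m \<le> length \<pi>" "m \<in> \<pi> ! (block_index \<pi> m - 1)"
proof -
  have "m \<in> \<Union> (set \<pi>)" using assms unfolding ordered_set_partitions_def by simp
  then obtain l where l: "l < length \<pi>" "m \<in> \<pi> ! l" by (auto simp: in_set_conv_nth)
  then have "block_index \<pi> m = Suc l" using \<pi> by (intro block_index_eqI) auto
  then show "1 \<le> block_index \<pi> m" "block_index \<pi> m \<le> length \<pi>" "m \<in> \<pi> ! (block_index \<pi> m - 1)"
    using l by simp_all
qed

text \<open>Recording for each element the number of its block turns an ordered set partition with \<open>p\<close>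
  blocks into a word with range exactly \<open>{1..p}\<close>, since no block is empty; conversely the blocks
  are the level sets of the word.\<close>

lemma sum_ordered_set_partitions:
  "(\<Sum>\<pi>\<in>ordered_set_partitions k. F (length \<pi>) (map (block_index \<pi>) [1..<k + 1])) =
    (\<Sum>p\<le>k. \<Sum>js | length js = k \<and> set js = {1..p}. F p js)"
proof -
  note upt_Suc [simp del]
  let ?word = "\<lambda>\<pi>. map (block_index \<pi>) [1..<k + 1]"
  let ?blocks = "\<lambda>(p, js). map (\<lambda>q. {m \<in> {1..k}. js ! (m - 1) = q}) [1..<p + 1]"
  let ?W = "SIGMA p:{..k}. {js. length js = k \<and> set js = {1..p}}"
  have fin: "finite {js :: nat list. length js = k \<and> set js = {1..p}}" for p
    by (rule finite_subset[OF _ finite_lists_length_eq[of "{1..p}" k]]) auto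
  have nth: "?word \<pi> ! (m - 1) = block_index \<pi> m" if "m \<in> {1..k}" for \<pi> m
    using that by (auto)
  have set_word: "set (?word \<pi>) = block_index \<pi> ` {1..k}" for \<pi>
    by (simp add: atLeastLessThanSuc_atLeastAtMost)
  have range: "set (?word \<pi>) = {1..length \<pi>}" if \<pi>: "\<pi> \<in> ordered_set_partitions k" for \<pi>
  proof (intro equalityI subsetI)
    fix q assume "q \<in> set (?word \<pi>)"
    then obtain m where "m \<in> {1..k}" "q = block_index \<pi> m"
      unfolding set_word by blast
    then show "q \<in> {1..length \<pi>}" using block_index_mem[OF \<pi>] by simp
  next
    fix q assume q: "q \<in> {1..length \<pi>}"
    then have "q - 1 < length \<pi>" unfolding atLeastAtMost_iff by linarith
    then have "\<pi> ! (q - 1) \<in> set \<pi>" by (rule nth_mem)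
    then have "\<pi> ! (q - 1) \<noteq> {}" "\<pi> ! (q - 1) \<subseteq> {1..k}"
      using \<pi> by (auto simp: ordered_set_partitions_def)
    then obtain m where m: "m \<in> \<pi> ! (q - 1)" "m \<in> {1..k}" by blast
    then have "block_index \<pi> m = q" using q \<pi> by (intro block_index_eqI) auto
    then show "q \<in> set (?word \<pi>)" unfolding set_word using m by blast
  qed
  have "(\<Sum>\<pi>\<in>ordered_set_partitions k. F (length \<pi>) (?word \<pi>)) = (\<Sum>(p, js)\<in>?W. F p js)"
  proof (rule sum.reindex_bij_witness[of _ ?blocks "\<lambda>\<pi>. (length \<pi>, ?word \<pi>)"])
    fix \<pi> assume \<pi>: "\<pi> \<in> ordered_set_partitions k"
    have "length \<pi> \<le> k"
      using card_length[of "?word \<pi>"] unfolding range[OF \<pi>] by simp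
    then show "(length \<pi>, ?word \<pi>) \<in> ?W"
      using range[OF \<pi>] by (simp)
    show "?blocks (length \<pi>, ?word \<pi>) = \<pi>"
    proof (rule nth_equalityI)
      fix l assume "l < length (?blocks (length \<pi>, ?word \<pi>))"
      then have l: "l < length \<pi>" by simp
      have "{m \<in> {1..k}. ?word \<pi> ! (m - 1) = Suc l} = {m \<in> {1..k}. block_index \<pi> m = Suc l}"
        by (rule Collect_cong, rule conj_cong[OF refl]) (simp only: nth)
      also have "\<dots> = \<pi> ! l"
      proof (intro equalityI subsetI)
        fix m assume "m \<in> {m \<in> {1..k}. block_index \<pi> m = Suc l}"
        then show "m \<in> \<pi> ! l" using block_index_mem(3)[OF \<pi>, of m] by simp
      next
        fix m assume m: "m \<in> \<pi> ! l"
        then have "m \<in> {1..k}"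
          using \<pi> l nth_mem[of l \<pi>] unfolding ordered_set_partitions_def by blast
        moreover have "block_index \<pi> m = Suc l" using \<pi> l m by (intro block_index_eqI) auto
        ultimately show "m \<in> {m \<in> {1..k}. block_index \<pi> m = Suc l}" by simp
      qed
      finally show "?blocks (length \<pi>, ?word \<pi>) ! l = \<pi> ! l"
        using l by (simp)
    qed simp
  next
    fix w assume "w \<in> ?W"
    then obtain p js where w: "w = (p, js)" and js: "length js = k" "set js = {1..p}" by auto
    have bl: "?blocks w ! (q - 1) = {m \<in> {1..k}. js ! (m - 1) = q}" if "1 \<le> q" "q \<le> p" for q
      using that by (simp add: w)
    have set_blocks: "set (?blocks w) = (\<lambda>q. {m \<in> {1..k}. js ! (m - 1) = q}) ` {1..p}"
      by (simp add: w atLeastLessThanSuc_atLeastAtMost)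
    have len: "length (?blocks w) = p" by (simp add: w)
    have pos: "1 \<le> js ! (m - 1) \<and> js ! (m - 1) \<le> p" if "m \<in> {1..k}" for m
      using that js nth_mem[of "m - 1" js] by auto
    have part: "?blocks w \<in> ordered_set_partitions k"
      unfolding ordered_set_partitions_def mem_Collect_eq
    proof (intro conjI ballI allI impI)
      fix B assume "B \<in> set (?blocks w)"
      then obtain q where q: "q \<in> {1..p}" "B = {m \<in> {1..k}. js ! (m - 1) = q}"
        unfolding set_blocks by blast
      then have "q \<in> set js" using js by simp
      then obtain l where "l < k" "js ! l = q" unfolding in_set_conv_nth js(1) by blast
      then have "Suc l \<in> B" using q by simp
      then show "B \<noteq> {}" by blast
    next
      fix r s assume "r < length (?blocks w)" "s < length (?blocks w)" "r \<noteq> s"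
      then show "?blocks w ! r \<inter> ?blocks w ! s = {}"
        unfolding len using bl[of "Suc r"] bl[of "Suc s"] by auto
    next
      show "\<Union> (set (?blocks w)) = {1..k}"
      proof (intro equalityI subsetI)
        fix m assume m: "m \<in> {1..k}"
        then have "js ! (m - 1) \<in> {1..p}" using pos[OF m] by simp
        then show "m \<in> \<Union> (set (?blocks w))" unfolding set_blocks using m by blast
      next
        fix m assume "m \<in> \<Union> (set (?blocks w))"
        then show "m \<in> {1..k}" unfolding set_blocks by blast
      qed
    qed
    show "?blocks w \<in> ordered_set_partitions k" by (rule part)
    have "?word (?blocks w) = js"
    proof (rule nth_equalityI)
      fix l assume "l < length (?word (?blocks w))"
      then have l: "Suc l \<in> {1..k}" by simp
      have "block_index (?blocks w) (Suc l) = js ! l"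
        using pos[OF l] l bl[of "js ! l"] len by (intro block_index_eqI[OF part]) auto
      then show "?word (?blocks w) ! l = js ! l" using nth[OF l, of "?blocks w"] by simp
    qed (simp add: js)
    then show "(length (?blocks w), ?word (?blocks w)) = w" using len w by simp
  qed (simp_all add: case_prod_unfold)
  also have "\<dots> = (\<Sum>p\<le>k. \<Sum>js | length js = k \<and> set js = {1..p}. F p js)"
    by (rule sum.Sigma[symmetric]) (simp, intro ballI fin)
  finally show ?thesis .
qed

section \<open>Words of leg operators\<close>

text \<open>The factor that the \<open>i\<close>-th leg operator has on the leg \<open>j\<close>; the last case is the projection onto
  the line spanned by the unit vector \<open>\<xi>\<close>.\<close>

definition leg_factor :: "'a::complex_inner \<Rightarrow> ('a \<Rightarrow> 'a) \<Rightarrow> nat \<Rightarrow> nat \<Rightarrow> 'a \<Rightarrow> 'a"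
  where "leg_factor \<xi> a j i =
    (if j < i then id else if j = i then a else (\<lambda>x. cinner \<xi> x *\<^sub>C \<xi>))"

definition leg_word :: "'a::complex_inner \<Rightarrow> ('a \<Rightarrow> 'a) \<Rightarrow> nat \<Rightarrow> nat list \<Rightarrow> 'a \<Rightarrow> 'a"
  where "leg_word \<xi> a j is = foldr (\<circ>) (map (leg_factor \<xi> a j) is) id"

definition tensor_word :: "'a::complex_inner \<Rightarrow> ('a \<Rightarrow> 'a) \<Rightarrow> nat \<Rightarrow> nat list \<Rightarrow>
    ('a list \<Rightarrow> complex) \<Rightarrow> ('a list \<Rightarrow> complex)"
  where "tensor_word \<xi> a N is = foldr (\<circ>) (map (leg_op \<xi> a N) is) id"

lemma leg_word_map:
  assumes "\<And>i. i \<in> set is \<Longrightarrow> (h j < h i \<longleftrightarrow> j < i) \<and> (h j = h i \<longleftrightarrow> j = i)"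
  shows "leg_word \<xi> a (h j) (map h is) = leg_word \<xi> a j is"
  using assms by (induction "is") (simp_all add: leg_word_def leg_factor_def)

locale leg_operators = finite_frame E for E :: "'a::complex_inner set" +
  fixes \<xi> :: 'a and a :: "'a \<Rightarrow> 'a"
  assumes unit: "cinner \<xi> \<xi> = 1" and selfadjoint: "selfadjoint a"
begin

lemma leg_op_selfadjoint:
  "A \<in> set (replicate (i - 1) id @ [a] @ replicate (N - i) (orth_proj (complex_vector.span {\<xi>})))
    \<Longrightarrow> selfadjoint A"
  by (auto simp: selfadjoint selfadjoint_id orth_proj_unit[OF unit, abs_def] selfadjoint_rank_one)

lemma clinear_leg_op: "clinear (leg_op \<xi> a N i)"
  unfolding leg_op_def by (rule clinear_tensor_op) (rule leg_op_selfadjoint)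

lemma leg_op_elem_tensor:
  assumes "1 \<le> i" "i \<le> N" "length xs = N"
  shows "leg_op \<xi> a N i (elem_tensor xs) =
    elem_tensor (map (\<lambda>j. leg_factor \<xi> a (Suc j) i (xs ! j)) [0..<N])"
proof -
  let ?Ts = "replicate (i - 1) id @ [a] @ replicate (N - i) (orth_proj (complex_vector.span {\<xi>}))"
  have "leg_op \<xi> a N i (elem_tensor xs) = elem_tensor (map2 (\<lambda>A x. A x) ?Ts xs)"
    unfolding leg_op_def
  proof (rule tensor_op_elem_tensor)
    show "selfadjoint A" if "A \<in> set ?Ts" for A using that by (rule leg_op_selfadjoint)
  qed (use assms in simp)
  also have "map2 (\<lambda>A x. A x) ?Ts xs = map (\<lambda>j. leg_factor \<xi> a (Suc j) i (xs ! j)) [0..<N]"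
    using assms by (intro nth_equalityI)
      (auto simp: leg_factor_def nth_append nth_Cons' orth_proj_unit[OF unit])
  finally show ?thesis .
qed

lemma clinear_tensor_word: "clinear (tensor_word \<xi> a N is)"
proof (induction "is")
  case Nil
  have "tensor_word \<xi> a N [] = id" by (simp add: tensor_word_def)
  then show ?case using clinear_id by metis
next
  case (Cons i "is")
  have "tensor_word \<xi> a N (i # is) = leg_op \<xi> a N i \<circ> tensor_word \<xi> a N is"
    by (simp add: tensor_word_def)
  then show ?case using clinear_comp[OF clinear_leg_op Cons] by metis
qed

lemma tensor_word_elem_tensor:
  assumes "set is \<subseteq> {1..N}" "length xs = N"
  shows "tensor_word \<xi> a N is (elem_tensor xs) =
    elem_tensor (map (\<lambda>j. leg_word \<xi> a (Suc j) is (xs ! j)) [0..<N])"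
  using assms(1)
proof (induction "is")
  case Nil
  have "map (\<lambda>j. xs ! j) [0..<N] = xs" using assms(2) map_nth by blast
  then show ?case by (simp add: tensor_word_def leg_word_def)
next
  case (Cons i "is")
  let ?ys = "map (\<lambda>j. leg_word \<xi> a (Suc j) is (xs ! j)) [0..<N]"
  have "tensor_word \<xi> a N (i # is) (elem_tensor xs) = leg_op \<xi> a N i (elem_tensor ?ys)"
    using Cons by (simp add: tensor_word_def)
  also have "\<dots> = elem_tensor (map (\<lambda>j. leg_factor \<xi> a (Suc j) i (?ys ! j)) [0..<N])"
    using Cons.prems by (intro leg_op_elem_tensor) auto
  also have "map (\<lambda>j. leg_factor \<xi> a (Suc j) i (?ys ! j)) [0..<N] =
      map (\<lambda>j. leg_word \<xi> a (Suc j) (i # is) (xs ! j)) [0..<N]"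
    by (simp add: leg_word_def)
  finally show ?case .
qed

definition pattern_weight :: "nat list \<Rightarrow> complex"
  where "pattern_weight is = (\<Prod>j\<in>set is. frame_trace (leg_word \<xi> a j is))"

lemma pattern_weight_map:
  assumes "strict_mono_on (set is) h"
  shows "pattern_weight (map h is) = pattern_weight is"
proof -
  have h: "inj_on h (set is)" using assms by (rule strict_mono_on_imp_inj_on)
  have "pattern_weight (map h is) = (\<Prod>j\<in>set is. frame_trace (leg_word \<xi> a (h j) (map h is)))"
    by (simp add: pattern_weight_def prod.reindex[OF h])
  also have "\<dots> = pattern_weight is"
    unfolding pattern_weight_def
  proof (rule prod.cong[OF refl])
    fix j assume j: "j \<in> set is"
    have "(h j < h i \<longleftrightarrow> j < i) \<and> (h j = h i \<longleftrightarrow> j = i)" if "i \<in> set is" for i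
      using j that assms inj_onD[OF h, of i j] inj_onD[OF h, of j i]
        strict_mono_onD[OF assms, of i j] strict_mono_onD[OF assms, of j i]
      by (metis less_asym linorder_neqE_nat)
    then show "frame_trace (leg_word \<xi> a (h j) (map h is)) = frame_trace (leg_word \<xi> a j is)"
      by (simp add: leg_word_map)
  qed
  finally show ?thesis .
qed

text \<open>Without the factor \<open>a\<close>, only copies of the identity and of the projection are multiplied, and the
  projection is idempotent.\<close>

lemma leg_word_unused:
  assumes "j \<notin> set is"
  shows "leg_word \<xi> a j is =
    (if \<forall>i\<in>set is. j < i then id else (\<lambda>x. cinner \<xi> x *\<^sub>C \<xi>))"
  using assms
  by (induction "is")
    (auto simp: leg_word_def leg_factor_def fun_eq_iff cinner_scaleC_right unit)

text \<open>The unused legs split into those before all indices, each contributing the trace of the identity,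
  and the rest, each contributing the trace \<open>\<langle>\<xi>, \<xi>\<rangle> = 1\<close> of the projection.\<close>

lemma tensor_trace_word:
  assumes "set is \<subseteq> {1..N}"
  shows "tensor_trace N (tensor_word \<xi> a N is) =
    frame_trace id ^ free_legs N (set is) * pattern_weight is"
proof -
  let ?S = "set is"
  have "tensor_trace N (tensor_word \<xi> a N is) =
      (\<Prod>j<N. frame_trace (leg_word \<xi> a (Suc j) is))"
    using tensor_word_elem_tensor[OF assms] by (intro tensor_trace_product clinear_tensor_word)
  also have "\<dots> = (\<Prod>j\<in>{1..N}. frame_trace (leg_word \<xi> a j is))"
    by (rule prod.reindex_bij_witness[of _ "\<lambda>j. j - 1" Suc]) auto
  also have "\<dots> = (\<Prod>j\<in>{1..N}. (if \<forall>i\<in>?S. j < i then frame_trace id else 1) *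
      (if j \<in> ?S then frame_trace (leg_word \<xi> a j is) else 1))"
    by (rule prod.cong) (auto simp: leg_word_unused frame_trace_rank_one unit)
  also have "\<dots> = frame_trace id ^ free_legs N ?S * pattern_weight is"
  proof -
    have "(\<Prod>j\<in>{1..N}. if \<forall>i\<in>?S. j < i then frame_trace id else 1) =
        frame_trace id ^ free_legs N ?S"
      by (simp add: free_legs_def flip: prod.inter_filter)
    moreover have "(\<Prod>j\<in>{1..N}. if j \<in> ?S then frame_trace (leg_word \<xi> a j is) else 1) =
        pattern_weight is"
    proof -
      have "{j \<in> {1..N}. j \<in> ?S} = ?S" using assms by auto
      then show ?thesis by (simp add: pattern_weight_def flip: prod.inter_filter)
    qed
    ultimately show ?thesis by (simp add: prod.distrib)
  qed
  finally show ?thesis .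
qed

lemma leg_sum_power:
  "(leg_sum \<xi> a N ^^ k) u = (\<Sum>is | set is \<subseteq> {1..N} \<and> length is = k. tensor_word \<xi> a N is u)"
proof (induction k)
  case 0
  have "{is. set is \<subseteq> {1..N} \<and> length is = 0} = {[]}" by auto
  then show ?case by (simp add: tensor_word_def)
next
  case (Suc k)
  have "(leg_sum \<xi> a N ^^ Suc k) u = (\<Sum>i = 1..N. leg_op \<xi> a N i ((leg_sum \<xi> a N ^^ k) u))"
    by (simp add: leg_sum_def)
  also have "\<dots> = (\<Sum>i = 1..N. \<Sum>is | set is \<subseteq> {1..N} \<and> length is = k.
      leg_op \<xi> a N i (tensor_word \<xi> a N is u))"
    by (simp only: Suc clinear_sum[OF clinear_leg_op])
  finally show ?case by (simp add: sum_lists_length_Suc tensor_word_def)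
qed

lemma tensor_trace_leg_sum_power:
  "tensor_trace N (leg_sum \<xi> a N ^^ k) =
    (\<Sum>is | set is \<subseteq> {1..N} \<and> length is = k.
      frame_trace id ^ free_legs N (set is) * pattern_weight is)"
proof -
  let ?L = "{is. set is \<subseteq> {1..N} \<and> length is = k}"
  have "tensor_trace N (leg_sum \<xi> a N ^^ k) =
      tensor_trace N (\<lambda>u. \<Sum>is\<in>?L. tensor_word \<xi> a N is u)"
    by (rule arg_cong[of _ _ "tensor_trace N"]) (rule ext, rule leg_sum_power)
  also have "\<dots> = (\<Sum>is\<in>?L. tensor_trace N (tensor_word \<xi> a N is))"
    by (rule tensor_trace_sum)
      (auto simp: clinear_tensor_word tensor_word_elem_tensor tensor_power_def
        intro!: complex_vector.span_base)
  also have "\<dots> = (\<Sum>is\<in>?L. frame_trace id ^ free_legs N (set is) * pattern_weight is)"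
    by (rule sum.cong) (auto simp: tensor_trace_word)
  finally show ?thesis .
qed

end

section \<open>The limit of the normalised moments\<close>

theorem theorem7p11:
  fixes \<xi> :: "'a::complex_inner" and a :: "'a \<Rightarrow> 'a" and d k :: nat
  assumes "complex_vector.dim (UNIV :: 'a set) = d" and "d \<ge> 2"
    and "cinner \<xi> \<xi> = 1"
    and "selfadjoint a"
    and "k \<ge> 1"
  shows "(\<lambda>N. tensor_trace N (leg_sum \<xi> a N ^^ k) / of_nat d ^ N)
    \<longlonglongrightarrow> (\<Sum>\<pi>\<in>ordered_set_partitions k.
          partition_moment \<xi> a k \<pi> / (of_nat d - 1) ^ length \<pi>)"
proof -
  obtain E :: "'a set" where E: "finite E" "orthonormal E" "card E = d"
    "\<And>x. x = (\<Sum>e\<in>E. cinner e x *\<^sub>C e)"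
    using orthonormal_basis_exists[OF assms(1)] assms(2) by auto
  interpret leg_operators E \<xi> a
    using E(1,4) assms(3,4) by unfold_locales
  have d: "frame_trace id = of_nat d"
    using E(2,3) by (simp add: frame_trace_id orthonormal_def)
  define W where "W p = (\<Sum>js | length js = k \<and> set js = {1..p}. pattern_weight js)" for p
  have G: "(\<Sum>R | R \<subseteq> {1..N} \<and> card R = p. of_nat d ^ free_legs N R) =
      complex_of_real (free_sum (real d) p N)" for N p
    by (simp add: free_sum_def)
  have "tensor_trace N (leg_sum \<xi> a N ^^ k) / of_nat d ^ N =
      (\<Sum>p\<le>k. of_real (free_sum (real d) p N / real d ^ N) * W p)" for N
  proof -
    have "tensor_trace N (leg_sum \<xi> a N ^^ k) =
        (\<Sum>p\<le>k. (\<Sum>R | R \<subseteq> {1..N} \<and> card R = p. of_nat d ^ free_legs N R) * W p)"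
      unfolding tensor_trace_leg_sum_power d W_def
      by (rule sum_lists_by_pattern[where f = "\<lambda>R. of_nat d ^ free_legs N R"])
        (rule pattern_weight_map)
    also have "\<dots> = (\<Sum>p\<le>k. of_real (free_sum (real d) p N) * W p)"
      by (simp only: G)
    finally show ?thesis by (simp add: sum_divide_distrib)
  qed
  moreover have "(\<lambda>N. \<Sum>p\<le>k. complex_of_real (free_sum (real d) p N / real d ^ N) * W p)
      \<longlonglongrightarrow> (\<Sum>p\<le>k. of_real (1 / (real d - 1) ^ p) * W p)"
  proof (rule tendsto_sum)
    fix p
    have "(\<lambda>N. complex_of_real (free_sum (real d) p N / real d ^ N))
        \<longlonglongrightarrow> complex_of_real (1 / (real d - 1) ^ p)"
      by (rule tendsto_of_real, rule free_sum_limit) (use assms(2) in simp)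
    then show "(\<lambda>N. complex_of_real (free_sum (real d) p N / real d ^ N) * W p)
        \<longlonglongrightarrow> complex_of_real (1 / (real d - 1) ^ p) * W p"
      by (rule tendsto_mult_right)
  qed
  moreover have "(\<Sum>\<pi>\<in>ordered_set_partitions k.
      partition_moment \<xi> a k \<pi> / (of_nat d - 1) ^ length \<pi>) =
      (\<Sum>p\<le>k. of_real (1 / (real d - 1) ^ p) * W p)"
  proof -
    have "partition_moment \<xi> a k \<pi> = tensor_trace (length \<pi>)
        (tensor_word \<xi> a (length \<pi>) (map (block_index \<pi>) [1..<k + 1]))" for \<pi>
      unfolding partition_moment_def tensor_word_def map_map comp_def ..
    then have "(\<Sum>\<pi>\<in>ordered_set_partitions k.
        partition_moment \<xi> a k \<pi> / (of_nat d - 1) ^ length \<pi>) =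
        (\<Sum>p\<le>k. \<Sum>js | length js = k \<and> set js = {1..p}.
          tensor_trace p (tensor_word \<xi> a p js) / (of_nat d - 1) ^ p)"
      using sum_ordered_set_partitions[of
          "\<lambda>p js. tensor_trace p (tensor_word \<xi> a p js) / (of_nat d - 1) ^ p" k]
      by simp
    also have "\<dots> = (\<Sum>p\<le>k. \<Sum>js | length js = k \<and> set js = {1..p}.
        pattern_weight js / (of_nat d - 1) ^ p)"
    proof (intro sum.cong refl)
      fix p :: nat and js :: "nat list"
      assume "js \<in> {js. length js = k \<and> set js = {1..p}}"
      then have js: "set js = {1..p}" by simp
      \<comment> \<open>A surjective word uses every leg, so no power of \<open>d\<close> appears.\<close>
      have "{j \<in> {1..p}. \<forall>r\<in>{1..p}. j < r} = {}" by auto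
      then have "free_legs p (set js) = 0" unfolding free_legs_def js by simp
      then have "tensor_trace p (tensor_word \<xi> a p js) = pattern_weight js"
        using tensor_trace_word[of js p] js by simp
      then show "tensor_trace p (tensor_word \<xi> a p js) / (of_nat d - 1) ^ p =
          pattern_weight js / (of_nat d - 1) ^ p"
        by (simp only:)
    qed
    also have "\<dots> = (\<Sum>p\<le>k. of_real (1 / (real d - 1) ^ p) * W p)"
      by (simp add: W_def sum_divide_distrib)
    finally show ?thesis .
  qed
  ultimately show ?thesis by (simp only:)
qed

end
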